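(* Let $A$ be a selfadjoint (possibly unbounded) linear operator in a complex Hilbert space $H$ with null space $N$. Let $f\in H$ and let $y$ in the domain of $A$ satisfy $Ay=f$ and $y\perp N$. For each constant $a>0$ let $u_a(t)$, $t\ge 0$, be the solution of the Cauchy problem $$\dot u_a=i(A+ia)u_a-if,\qquad u_a(0)=0 .$$ Then $$\lim_{a\to 0}\ \lim_{t\to\infty}u_a(t)=y ,$$ where the limits are in the norm of $H$ and $a\to0$ through positive values.
   Context: $N=N(A)=\{u: Au=0\}$ is the null space of $A$; $\dot u=du/dt$; $I$ is the identity and $A+ia$ means $A+iaI$. Selfadjoint operators are densely defined and closed. The solution of the Cauchy problem is $u_a(t)=\int_0^t e^{i(A+ia)(t-s)}(-if)\,ds$, where $e^{i(A+ia)t}=e^{-at}e^{iAt}$. *)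

theory Defs
  imports "HOL-Analysis.Analysis"
begin

text \<open>
  The inner product is linear in its first argument. Positivity and definiteness are
  contained in the axiom \<open>cinner_self\<close>, because the norm is already one; completeness comes
  from \<^class>\<open>banach\<close>.
\<close>

class chilbert_space = banach +
  fixes scaleC :: "complex \<Rightarrow> 'a \<Rightarrow> 'a" (infixr "*\<^sub>C" 75)
    and cinner :: "'a \<Rightarrow> 'a \<Rightarrow> complex"
  assumes scaleC_add_right: "c *\<^sub>C (x + y) = c *\<^sub>C x + c *\<^sub>C y"
    and scaleC_add_left: "(c + d) *\<^sub>C x = c *\<^sub>C x + d *\<^sub>C x"
    and scaleC_scaleC: "c *\<^sub>C d *\<^sub>C x = (c * d) *\<^sub>C x"
    and scaleC_of_real: "complex_of_real r *\<^sub>C x = r *\<^sub>R x"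
    and cinner_commute: "cinner x y = cnj (cinner y x)"
    and cinner_add_left: "cinner (x + y) z = cinner x z + cinner y z"
    and cinner_scaleC_left: "cinner (c *\<^sub>C x) y = c * cinner x y"
    and cinner_self: "cinner x x = complex_of_real ((norm x)\<^sup>2)"

text \<open>
  An unbounded operator is a domain \<open>D\<close> together with a function \<open>A\<close> that is only meaningful
  on \<open>D\<close>; every notion below uses the values of \<open>A\<close> on \<open>D\<close> alone.
\<close>

definition linear_operator :: "'a::chilbert_space set \<Rightarrow> ('a \<Rightarrow> 'a) \<Rightarrow> bool" where
  "linear_operator D A \<longleftrightarrow>
     0 \<in> D \<and>
     (\<forall>x\<in>D. \<forall>y\<in>D. x + y \<in> D \<and> A (x + y) = A x + A y) \<and>
     (\<forall>c. \<forall>x\<in>D. c *\<^sub>C x \<in> D \<and> A (c *\<^sub>C x) = c *\<^sub>C A x)"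

definition adjoint_domain :: "'a::chilbert_space set \<Rightarrow> ('a \<Rightarrow> 'a) \<Rightarrow> 'a set" where
  "adjoint_domain D A = {v. \<exists>w. \<forall>u\<in>D. cinner (A u) v = cinner u w}"

text \<open>For dense \<open>D\<close> and \<open>v\<close> in the adjoint domain, the vector described here is unique.\<close>

definition adjoint_operator :: "'a::chilbert_space set \<Rightarrow> ('a \<Rightarrow> 'a) \<Rightarrow> 'a \<Rightarrow> 'a" where
  "adjoint_operator D A v = (THE w. \<forall>u\<in>D. cinner (A u) v = cinner u w)"

text \<open>Closedness is not listed: it follows, since an adjoint is always closed.\<close>

definition selfadjoint_operator :: "'a::chilbert_space set \<Rightarrow> ('a \<Rightarrow> 'a) \<Rightarrow> bool" where
  "selfadjoint_operator D A \<longleftrightarrow>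
     linear_operator D A \<and> closure D = UNIV \<and>
     adjoint_domain D A = D \<and> (\<forall>v\<in>D. adjoint_operator D A v = A v)"

definition null_space :: "'a::chilbert_space set \<Rightarrow> ('a \<Rightarrow> 'a) \<Rightarrow> 'a set" where
  "null_space D A = {u \<in> D. A u = 0}"

text \<open>
  Classical solutions on \<open>[0, \<infinity>)\<close>, with a one-sided derivative at \<open>0\<close>. As the inhomogeneity
  does not depend on time, the solution given by the variation of constants formula takes
  its values in \<open>D\<close> and is a solution in this sense, for every vector \<open>f\<close>.
\<close>

definition solves_cauchy ::
    "'a::chilbert_space set \<Rightarrow> ('a \<Rightarrow> 'a) \<Rightarrow> 'a \<Rightarrow> real \<Rightarrow> (real \<Rightarrow> 'a) \<Rightarrow> bool" where
  "solves_cauchy D A f a u \<longleftrightarrow>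
     u 0 = 0 \<and>
     (\<forall>t\<ge>0. u t \<in> D \<and>
        (u has_vector_derivative
           \<i> *\<^sub>C (A (u t) + (\<i> * complex_of_real a) *\<^sub>C u t) - \<i> *\<^sub>C f) (at t within {0..}))"

text \<open>The values at negative times are irrelevant; they are fixed so that the solution is unique.\<close>

definition cauchy_solution ::
    "'a::chilbert_space set \<Rightarrow> ('a \<Rightarrow> 'a) \<Rightarrow> 'a \<Rightarrow> real \<Rightarrow> real \<Rightarrow> 'a" where
  "cauchy_solution D A f a = (THE u. solves_cauchy D A f a u \<and> (\<forall>t<0. u t = 0))"

end

theory Submission
  imports Defs
begin

text \<open>
  The solution can be written down. For \<open>a > 0\<close> the resolvent equation \<open>(A + ia) v = f\<close> has a
  unique solution \<open>v = v\<^sub>a\<close>; it is a stationary solution of the differential equation, so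
  \<open>u\<^sub>a(t) = v\<^sub>a - e\<^sup>-\<^sup>a\<^sup>t S(t) v\<^sub>a\<close>, where \<open>S(t) = e\<^sup>i\<^sup>A\<^sup>t\<close> is the evolution generated by
  \<open>iA\<close>. As \<open>S(t)\<close> does not increase the norm, \<open>u\<^sub>a(t)\<close> tends to \<open>v\<^sub>a\<close> when \<open>t \<rightarrow> \<infinity>\<close>.
  With \<open>f = A y\<close> one finds \<open>v\<^sub>a = y - J\<^sub>a y\<close> for \<open>J\<^sub>a = ia (A + ia)\<^sup>-\<^sup>1\<close>, a contraction. On the
  range of \<open>A\<close> the vector \<open>J\<^sub>a (A z) = ia (z - J\<^sub>a z)\<close> is of order \<open>a\<close>, hence \<open>J\<^sub>a \<rightarrow> 0\<close> strongly
  on the closure of the range, which is the orthogonal complement of the null space and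
  contains \<open>y\<close>: this is \<open>J_tendsto_0_if_orthogonal_null_space\<close>.

  Three ingredients carry this. Orthogonal complements enter through
  \<open>in_closure_if_annihilated\<close>, the double annihilator theorem. It also gives the resolvent
  (\<open>shift_surj\<close>), since a vector orthogonal to the range of \<open>A + ic\<close> would be an eigenvector
  with a non-real eigenvalue. Finally, \<open>S(t)\<close> comes from Yosida's construction, which
  avoids the spectral theorem: the same \<open>J\<^sub>c\<close>, now with \<open>c \<rightarrow> \<infinity>\<close>, turns \<open>iA\<close> into the bounded
  operators \<open>iAJ\<^sub>c = c (J\<^sub>c - 1)\<close>, whose exponentials are power series and contractions. They
  converge as \<open>c \<rightarrow> \<infinity>\<close>, by an energy estimate that uses only that \<open>\<langle>Au, u\<rangle>\<close> is real
  (\<open>yosida_flow_dist_le\<close>); closedness of \<open>A\<close> then shows that the limit is a classical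
  solution for initial values in the domain. The energy identity also makes the
  solution of the Cauchy problem unique (\<open>solves_cauchy_unique\<close>), which pins down the
  definite description in \<open>cauchy_solution\<close>.
\<close>

section \<open>Complex Hilbert spaces\<close>

lemma scaleC_zero_left [simp]: "0 *\<^sub>C x = (0::'a::chilbert_space)"
  using scaleC_of_real[of 0 x] by simp

lemma scaleC_one [simp]: "1 *\<^sub>C x = (x::'a::chilbert_space)"
  using scaleC_of_real[of 1 x] by simp

lemma scaleC_minus_left: "(- c) *\<^sub>C x = - (c *\<^sub>C (x::'a::chilbert_space))"
  using scaleC_add_left[of c "- c" x] by (simp add: eq_neg_iff_add_eq_0 add.commute)

lemma scaleC_zero_right [simp]: "c *\<^sub>C 0 = (0::'a::chilbert_space)"
  using scaleC_add_right[of c 0 "0::'a"] by simp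

lemma scaleC_minus_right: "c *\<^sub>C (- x) = - (c *\<^sub>C (x::'a::chilbert_space))"
  using scaleC_add_right[of c x "- x"] by (simp add: eq_neg_iff_add_eq_0 add.commute)

lemma scaleC_diff_right: "c *\<^sub>C (x - y) = c *\<^sub>C x - c *\<^sub>C (y::'a::chilbert_space)"
  using scaleC_add_right[of c x "- y"] by (simp add: scaleC_minus_right)

lemma scaleC_scaleR: "c *\<^sub>C (r *\<^sub>R x) = r *\<^sub>R (c *\<^sub>C (x::'a::chilbert_space))"
  by (simp add: scaleC_of_real[symmetric] scaleC_scaleC mult.commute)

lemma cinner_scaleC_right: "cinner x (c *\<^sub>C y) = cnj c * cinner x (y::'a::chilbert_space)"
  by (subst (1 2) cinner_commute) (simp add: cinner_scaleC_left)

lemma cinner_add_right: "cinner x (y + z) = cinner x y + cinner x (z::'a::chilbert_space)"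
  by (subst (1 2 3) cinner_commute) (simp add: cinner_add_left)

lemma norm_scaleC: "norm (c *\<^sub>C x) = cmod c * norm (x::'a::chilbert_space)"
proof -
  have "complex_of_real ((norm (c *\<^sub>C x))\<^sup>2) = (c * cnj c) * complex_of_real ((norm x)\<^sup>2)"
    unfolding cinner_self[symmetric] cinner_scaleC_left cinner_scaleC_right by simp
  also have "\<dots> = complex_of_real ((cmod c * norm x)\<^sup>2)"
    using complex_norm_square[of c] by (simp add: power_mult_distrib)
  finally have "(norm (c *\<^sub>C x))\<^sup>2 = (cmod c * norm x)\<^sup>2"
    unfolding of_real_eq_iff .
  then show ?thesis by (simp add: power2_eq_iff_nonneg)
qed

lemma norm_add_square:
  "(norm (x + y))\<^sup>2 = (norm x)\<^sup>2 + 2 * Re (cinner x y) + (norm (y::'a::chilbert_space))\<^sup>2"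
proof -
  have "cinner (x + y) (x + y) = cinner x x + cinner x y + cnj (cinner x y) + cinner y y"
    using cinner_commute[of y x] by (simp add: cinner_add_left cinner_add_right)
  then have "Re (cinner (x + y) (x + y)) = Re (cinner x x + cinner x y + cnj (cinner x y) + cinner y y)"
    by simp
  then show ?thesis by (simp add: cinner_self)
qed

text \<open>
  As the norm is given as a norm, Cauchy--Schwarz for the real part is the triangle
  inequality, squared.
\<close>

lemma Re_cinner_le: "Re (cinner x y) \<le> norm x * norm (y::'a::chilbert_space)"
proof -
  have "(norm (x + y))\<^sup>2 \<le> (norm x + norm y)\<^sup>2"
    by (intro power_mono norm_triangle_ineq) simp
  then show ?thesis by (simp add: norm_add_square power2_sum)
qed

lemma abs_Re_cinner_le: "\<bar>Re (cinner x y)\<bar> \<le> norm x * norm (y::'a::chilbert_space)"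
proof -
  have "Re (cinner ((- 1) *\<^sub>C x) y) \<le> norm ((- 1) *\<^sub>C x) * norm y" by (rule Re_cinner_le)
  then show ?thesis
    using Re_cinner_le[of x y] by (simp add: cinner_scaleC_left norm_scaleC)
qed

lemma bounded_bilinear_cinner: "bounded_bilinear (cinner :: 'a::chilbert_space \<Rightarrow> 'a \<Rightarrow> complex)"
proof
  show "\<exists>K. \<forall>a b::'a. norm (cinner a b) \<le> norm a * norm b * K"
  proof (intro exI[of _ 2] allI)
    fix a b :: 'a
    have "\<bar>Im (cinner a b)\<bar> = \<bar>Re (cinner (\<i> *\<^sub>C a) b)\<bar>"
      by (simp add: cinner_scaleC_left)
    also have "\<dots> \<le> norm a * norm b"
      using abs_Re_cinner_le[of "\<i> *\<^sub>C a" b] by (simp add: norm_scaleC)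
    finally show "norm (cinner a b) \<le> norm a * norm b * 2"
      using abs_Re_cinner_le[of a b] cmod_le[of "cinner a b"] by simp
  qed
qed (auto simp: cinner_add_left cinner_add_right scaleC_of_real[symmetric] cinner_scaleC_left
       cinner_scaleC_right scaleR_conv_of_real)

interpretation cinner: bounded_bilinear "cinner :: 'a::chilbert_space \<Rightarrow> 'a \<Rightarrow> complex"
  by (rule bounded_bilinear_cinner)

lemma bounded_linear_scaleC: "bounded_linear (\<lambda>x::'a::chilbert_space. c *\<^sub>C x)"
  by (rule bounded_linear_intro[where K = "cmod c"])
    (auto simp: scaleC_add_right scaleC_scaleR norm_scaleC mult.commute)

lemmas tendsto_scaleC = bounded_linear.tendsto[OF bounded_linear_scaleC]

lemma cinner_eq_zero_iff [simp]: "cinner x x = 0 \<longleftrightarrow> x = (0::'a::chilbert_space)"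
  by (simp add: cinner_self)

lemma norm_diff_square:
  "(norm (x - y))\<^sup>2 = (norm x)\<^sup>2 - 2 * Re (cinner x y) + (norm (y::'a::chilbert_space))\<^sup>2"
  using norm_add_square[of x "- y"] by (simp add: cinner.minus_right)

lemma cinner_dense_eq_zero:
  fixes w :: "'a::chilbert_space"
  assumes "closure D = UNIV" and "\<And>u. u \<in> D \<Longrightarrow> cinner u w = 0"
  shows "w = 0"
proof -
  obtain s where s: "\<And>n. s n \<in> D" "s \<longlonglongrightarrow> w"
    using assms(1) closure_sequential[of w D] by auto
  have "(\<lambda>n. cinner (s n) w) \<longlonglongrightarrow> cinner w w"
    by (intro cinner.tendsto s tendsto_const)
  then have "cinner w w = 0"
    using s assms(2) by (simp add: LIMSEQ_const_iff)
  then show ?thesis by simp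
qed

section \<open>Closures of subspaces and orthogonality\<close>

text \<open>
  The double annihilator theorem for a linear subspace. A minimizing sequence for the distance
  from \<open>x\<close> to \<open>M\<close> is Cauchy by the parallelogram law, and the error at its limit is orthogonal
  to \<open>M\<close>, hence to \<open>x\<close>, hence to itself.
\<close>

lemma in_closure_if_annihilated:
  fixes x :: "'a::chilbert_space"
  assumes zero: "0 \<in> M" and add: "\<And>u v. u \<in> M \<Longrightarrow> v \<in> M \<Longrightarrow> u + v \<in> M"
    and scale: "\<And>c u. u \<in> M \<Longrightarrow> c *\<^sub>C u \<in> M"
    and annih: "\<And>v. (\<And>z. z \<in> M \<Longrightarrow> cinner z v = 0) \<Longrightarrow> cinner x v = 0"
  shows "x \<in> closure M"
proof -
  define d where "d = infdist x M"
  have d_le: "d \<le> norm (x - m)" if "m \<in> M" for m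
    using infdist_le[OF that, of x] by (simp add: d_def dist_norm)
  have d0: "0 \<le> d" by (simp add: d_def infdist_nonneg)
  have "\<exists>m\<in>M. norm (x - m) < d + 1 / real (Suc n)" for n
  proof -
    have "d = (INF a\<in>M. dist x a)"
      unfolding d_def using zero by (intro infdist_notempty) auto
    then have "(INF a\<in>M. dist x a) < d + 1 / real (Suc n)" by simp
    moreover have "bdd_below (dist x ` M)" by (rule bdd_belowI2[of _ 0]) simp
    ultimately show ?thesis
      using zero by (subst (asm) cINF_less_iff) (auto simp: dist_norm)
  qed
  then obtain m where m: "\<And>n. m n \<in> M" "\<And>n. norm (x - m n) < d + 1 / real (Suc n)"
    by metis
  have "(\<lambda>n. d + 1 / real (Suc n)) \<longlonglongrightarrow> d + 0"
    by (intro tendsto_intros LIMSEQ_Suc[OF lim_1_over_n])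
  then have upper: "(\<lambda>n. d + 1 / real (Suc n)) \<longlonglongrightarrow> d" by simp
  have m_lim: "(\<lambda>n. norm (x - m n)) \<longlonglongrightarrow> d"
  proof (rule tendsto_sandwich[OF _ _ tendsto_const upper])
    show "\<forall>\<^sub>F n in sequentially. d \<le> norm (x - m n)"
      by (intro always_eventually allI d_le m)
    show "\<forall>\<^sub>F n in sequentially. norm (x - m n) \<le> d + 1 / real (Suc n)"
      by (intro always_eventually allI less_imp_le m)
  qed
  have sq_lim: "(\<lambda>n. (norm (x - m n))\<^sup>2) \<longlonglongrightarrow> d\<^sup>2"
    by (intro tendsto_intros m_lim)
  have "Cauchy m"
  proof (rule metric_CauchyI)
    fix e :: real assume "0 < e"
    have "eventually (\<lambda>n. (norm (x - m n))\<^sup>2 < d\<^sup>2 + e\<^sup>2 / 4) sequentially"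
      using \<open>0 < e\<close> by (intro order_tendstoD(2)[OF sq_lim]) simp
    then obtain N where N: "\<And>n. n \<ge> N \<Longrightarrow> (norm (x - m n))\<^sup>2 < d\<^sup>2 + e\<^sup>2 / 4"
      by (auto simp: eventually_sequentially)
    have "dist (m i) (m j) < e" if "i \<ge> N" "j \<ge> N" for i j
    proof -
      have half: "(1/2) *\<^sub>C (m i + m j) \<in> M" using m add scale by simp
      have "(x - m i) + (x - m j) = 2 *\<^sub>R (x - (1/2) *\<^sub>C (m i + m j))"
        using scaleC_of_real[of "1/2" "m i + m j"] by (simp add: algebra_simps scaleR_2)
      then have "norm ((x - m i) + (x - m j)) \<ge> 2 * d"
        using d_le[OF half] by simp
      then have "(2 * d)\<^sup>2 \<le> (norm ((x - m i) + (x - m j)))\<^sup>2"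
        using d0 by (intro power_mono) auto
      moreover have "(norm ((x - m i) - (x - m j)))\<^sup>2 + (norm ((x - m i) + (x - m j)))\<^sup>2
          = 2 * (norm (x - m i))\<^sup>2 + 2 * (norm (x - m j))\<^sup>2"
        unfolding norm_diff_square[of "x - m i"] norm_add_square[of "x - m i"] by simp
      moreover have "(norm ((x - m i) - (x - m j)))\<^sup>2 = (dist (m i) (m j))\<^sup>2"
        by (simp add: dist_norm norm_minus_commute)
      ultimately have "(dist (m i) (m j))\<^sup>2 < e\<^sup>2"
        using N[OF that(1)] N[OF that(2)] by (simp add: power2_eq_square)
      then show ?thesis using \<open>0 < e\<close> by (simp add: power_less_imp_less_base)
    qed
    then show "\<exists>N. \<forall>i\<ge>N. \<forall>j\<ge>N. dist (m i) (m j) < e" by blast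
  qed
  then obtain p where p: "m \<longlonglongrightarrow> p" using Cauchy_convergent convergent_def by blast
  have p_dist: "norm (x - p) = d"
    using LIMSEQ_unique[OF m_lim tendsto_norm[OF tendsto_diff[OF tendsto_const p]]] by simp
  define v where "v = x - p"
  have v_norm: "norm v = d" using p_dist by (simp add: v_def)
  have Re_zero: "Re (cinner v z) = 0" if z: "z \<in> M" for z
  proof (cases "z = 0")
    case False
    define s where "s = Re (cinner v z) / (norm z)\<^sup>2"
    have "s *\<^sub>R z \<in> M" using scale[OF z, of "of_real s"] by (simp add: scaleC_of_real)
    then have lower: "d \<le> norm (x - (m n + s *\<^sub>R z))" for n
      using m by (intro d_le add)
    have "(\<lambda>n. norm (x - (m n + s *\<^sub>R z))) \<longlonglongrightarrow> norm (x - (p + s *\<^sub>R z))"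
      by (intro tendsto_intros p)
    then have "d \<le> norm (x - (p + s *\<^sub>R z))"
      by (rule LIMSEQ_le_const) (simp add: lower)
    then have "d \<le> norm (v - s *\<^sub>R z)" by (simp add: v_def diff_diff_add)
    then have "d\<^sup>2 \<le> (norm (v - s *\<^sub>R z))\<^sup>2" using d0 by (intro power_mono)
    also have "\<dots> = d\<^sup>2 - 2 * (s * Re (cinner v z)) + s\<^sup>2 * (norm z)\<^sup>2"
      unfolding norm_diff_square[of v] by (simp add: cinner.scaleR_right power_mult_distrib v_norm)
    also have "\<dots> = d\<^sup>2 - (Re (cinner v z))\<^sup>2 / (norm z)\<^sup>2"
      using False by (simp add: s_def power2_eq_square)
    finally have "(Re (cinner v z))\<^sup>2 / (norm z)\<^sup>2 \<le> 0" by simp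
    then show ?thesis using False by (simp add: divide_le_0_iff)
  qed (simp add: cinner.zero_right)
  have orth: "cinner z v = 0" if z: "z \<in> M" for z
  proof -
    have "Im (cinner v z) = 0"
      using Re_zero[OF scale[OF z, of \<i>]] by (simp add: cinner_scaleC_right)
    then have "cinner v z = 0" using Re_zero[OF z] by (simp add: complex_eq_iff)
    then show ?thesis using cinner_commute[of z v] by simp
  qed
  have "(\<lambda>n. cinner (m n) v) \<longlonglongrightarrow> cinner p v"
    by (intro cinner.tendsto p tendsto_const)
  then have "cinner p v = 0" using orth m by (simp add: LIMSEQ_const_iff)
  moreover have "cinner v v = cinner x v - cinner p v"
    by (subst (1) v_def) (rule cinner.diff_left)
  ultimately have "cinner v v = 0" using annih[OF orth] by simp
  then have "x = p" by (simp add: v_def)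
  then show ?thesis using m p closure_sequential by blast
qed

section \<open>Selfadjoint operators and their resolvents\<close>

locale selfadjoint =
  fixes D :: "'a::chilbert_space set" and A :: "'a \<Rightarrow> 'a"
  assumes selfadjoint: "selfadjoint_operator D A"
begin

lemma D_zero: "0 \<in> D" and D_add: "\<And>x y. x \<in> D \<Longrightarrow> y \<in> D \<Longrightarrow> x + y \<in> D"
  and A_add: "\<And>x y. x \<in> D \<Longrightarrow> y \<in> D \<Longrightarrow> A (x + y) = A x + A y"
  and D_scaleC: "\<And>c x. x \<in> D \<Longrightarrow> c *\<^sub>C x \<in> D"
  and A_scaleC: "\<And>c x. x \<in> D \<Longrightarrow> A (c *\<^sub>C x) = c *\<^sub>C A x"
  and D_dense: "closure D = UNIV"
  using selfadjoint unfolding selfadjoint_operator_def linear_operator_def by auto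

lemma D_scaleR: "x \<in> D \<Longrightarrow> r *\<^sub>R x \<in> D" and A_scaleR: "x \<in> D \<Longrightarrow> A (r *\<^sub>R x) = r *\<^sub>R A x"
  by (simp_all add: scaleC_of_real[symmetric] D_scaleC A_scaleC)

lemma D_diff: "x \<in> D \<Longrightarrow> y \<in> D \<Longrightarrow> x - y \<in> D"
  using D_add[of x "- y"] D_scaleR[of y "- 1"] by simp

lemma A_diff: "x \<in> D \<Longrightarrow> y \<in> D \<Longrightarrow> A (x - y) = A x - A y"
  using A_add[of x "- y"] A_scaleR[of y "- 1"] D_scaleR[of y "- 1"] by simp

lemma adjoint_relation_unique:
  assumes "\<And>u. u \<in> D \<Longrightarrow> cinner u w = cinner u w'"
  shows "w = w'"
  using cinner_dense_eq_zero[OF D_dense, of "w - w'"] assms by (simp add: cinner.diff_right)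

text \<open>
  Selfadjointness as a relation between \<open>v\<close> and \<open>w\<close>: the form in which an element is shown
  to lie in the domain.
\<close>

lemma graph_iff: "(\<forall>u\<in>D. cinner (A u) v = cinner u w) \<longleftrightarrow> v \<in> D \<and> A v = w"
proof
  assume *: "\<forall>u\<in>D. cinner (A u) v = cinner u w"
  then have "v \<in> adjoint_domain D A" by (auto simp: adjoint_domain_def)
  then have "v \<in> D" and "adjoint_operator D A v = A v"
    using selfadjoint by (auto simp: selfadjoint_operator_def)
  moreover have "adjoint_operator D A v = w"
    unfolding adjoint_operator_def using * by (intro the_equality) (auto intro: adjoint_relation_unique)
  ultimately show "v \<in> D \<and> A v = w" by simp
next
  assume v: "v \<in> D \<and> A v = w"
  then have "v \<in> adjoint_domain D A" and "adjoint_operator D A v = w"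
    using selfadjoint by (auto simp: selfadjoint_operator_def)
  then obtain w' where w': "\<forall>u\<in>D. cinner (A u) v = cinner u w'"
    by (auto simp: adjoint_domain_def)
  then have "adjoint_operator D A v = w'"
    unfolding adjoint_operator_def by (intro the_equality) (auto intro: adjoint_relation_unique)
  with w' \<open>adjoint_operator D A v = w\<close> show "\<forall>u\<in>D. cinner (A u) v = cinner u w" by simp
qed

lemma symmetric: "u \<in> D \<Longrightarrow> v \<in> D \<Longrightarrow> cinner (A u) v = cinner u (A v)"
  using graph_iff[of v "A v"] by simp

lemma Im_form_eq_zero:
  assumes "u \<in> D"
  shows "Im (cinner (A u) u) = 0"
proof -
  have "cinner (A u) u = cnj (cinner (A u) u)"
    using symmetric[OF assms assms] cinner_commute[of u "A u"] by simp
  from arg_cong[OF this, of Im] show ?thesis by simp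
qed

text \<open>Multiplication by \<open>\<i>\<close> makes \<open>A\<close> conservative; every energy estimate rests on this.\<close>

lemma Re_i_form_eq_zero: "u \<in> D \<Longrightarrow> Re (cinner (\<i> *\<^sub>C A u) u) = 0"
  using Im_form_eq_zero[of u] by (simp add: cinner_scaleC_left)

lemma graph_closed:
  assumes s: "\<And>n. s n \<in> D" "s \<longlonglongrightarrow> v" "(\<lambda>n. A (s n)) \<longlonglongrightarrow> w"
  shows "v \<in> D \<and> A v = w"
proof -
  have "cinner (A u) v = cinner u w" if "u \<in> D" for u
  proof (rule LIMSEQ_unique)
    show "(\<lambda>n. cinner (A u) (s n)) \<longlonglongrightarrow> cinner (A u) v"
      by (intro cinner.tendsto s tendsto_const)
    show "(\<lambda>n. cinner (A u) (s n)) \<longlonglongrightarrow> cinner u w"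
      using symmetric[OF that s(1)] by (simp add: cinner.tendsto[OF tendsto_const s(3)])
  qed
  then show ?thesis using graph_iff by blast
qed

lemma shift_lower_bound:
  assumes "x \<in> D" "0 < c"
  shows "c * norm x \<le> norm (A x + (\<i> * of_real c) *\<^sub>C x)"
proof -
  have "(norm (A x + (\<i> * of_real c) *\<^sub>C x))\<^sup>2 = (norm (A x))\<^sup>2 + (c * norm x)\<^sup>2"
    using Im_form_eq_zero[OF assms(1)]
    by (simp add: norm_add_square cinner_scaleC_right norm_scaleC norm_mult power_mult_distrib)
  then have "(c * norm x)\<^sup>2 \<le> (norm (A x + (\<i> * of_real c) *\<^sub>C x))\<^sup>2" by simp
  then show ?thesis by (rule power2_le_imp_le) simp
qed

text \<open>
  The range of \<open>A + ic\<close> is closed, because the operator is bounded below and closed, and it is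
  dense, because a vector orthogonal to it would be an eigenvector of \<open>A\<close> with the
  eigenvalue \<open>ic\<close>.
\<close>

lemma shift_surj:
  assumes "0 < c"
  shows "\<exists>z\<in>D. A z + (\<i> * of_real c) *\<^sub>C z = g"
proof -
  let ?L = "\<lambda>z. A z + (\<i> * of_real c) *\<^sub>C z"
  have L_diff: "?L (x - y) = ?L x - ?L y" if "x \<in> D" "y \<in> D" for x y
    using that by (simp add: A_diff scaleC_diff_right)
  have "g \<in> closure (?L ` D)"
  proof (rule in_closure_if_annihilated)
    show "0 \<in> ?L ` D"
      using D_zero A_scaleR[OF D_zero, of 0] by (intro image_eqI[of _ _ 0]) auto
    fix u assume u: "u \<in> ?L ` D"
    then obtain x where x: "x \<in> D" "u = ?L x" by auto
    show "k *\<^sub>C u \<in> ?L ` D" for k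
      using x by (intro image_eqI[of _ _ "k *\<^sub>C x"])
        (auto simp: A_scaleC D_scaleC scaleC_add_right scaleC_scaleC mult.commute)
    fix v assume "v \<in> ?L ` D"
    then obtain y where y: "y \<in> D" "v = ?L y" by auto
    show "u + v \<in> ?L ` D"
      using x y by (intro image_eqI[of _ _ "x + y"])
        (auto simp: A_add D_add scaleC_add_right algebra_simps)
  next
    fix v assume orth: "\<And>z. z \<in> ?L ` D \<Longrightarrow> cinner z v = 0"
    \<comment> \<open>So \<open>v\<close> is in the domain of the adjoint, and an eigenvector with the eigenvalue \<open>ic\<close>.\<close>
    have "cinner (A u) v = cinner u ((\<i> * of_real c) *\<^sub>C v)" if "u \<in> D" for u
      using orth[OF imageI[OF that]]
      by (simp add: cinner_add_left cinner_scaleC_left cinner_scaleC_right eq_neg_iff_add_eq_0)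
    then have v: "v \<in> D" "A v = (\<i> * of_real c) *\<^sub>C v" using graph_iff by blast+
    then have "c * (norm v)\<^sup>2 = 0"
      using Im_form_eq_zero[OF v(1)] by (simp add: cinner_scaleC_left cinner_self flip: of_real_mult of_real_power)
    then have "v = 0" using assms by simp
    then show "cinner g v = 0" by (simp add: cinner.zero_right)
  qed
  then obtain h where h: "\<And>n. h n \<in> ?L ` D" "h \<longlonglongrightarrow> g"
    using closure_sequential[of g] by blast
  then have "\<forall>n. \<exists>z. z \<in> D \<and> h n = ?L z" by blast
  then have "\<exists>s. \<forall>n. s n \<in> D \<and> h n = ?L (s n)" by (rule choice)
  then obtain s where s: "\<And>n. s n \<in> D" "\<And>n. h n = ?L (s n)"
    by blast
  have "Cauchy s"
  proof (rule metric_CauchyI)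
    fix e :: real assume "0 < e"
    then have "0 < c * e" using assms by simp
    then obtain N where N: "\<And>i j. i \<ge> N \<Longrightarrow> j \<ge> N \<Longrightarrow> dist (h i) (h j) < c * e"
      using metric_CauchyD[OF LIMSEQ_imp_Cauchy[OF h(2)]] by blast
    have "dist (s i) (s j) < e" if "i \<ge> N" "j \<ge> N" for i j
    proof -
      have "c * dist (s i) (s j) \<le> dist (h i) (h j)"
        using shift_lower_bound[OF D_diff[OF s(1) s(1)] assms, of i j] L_diff[OF s(1) s(1), of i j]
        by (simp add: s(2) dist_norm)
      then have "c * dist (s i) (s j) < c * e" using N[OF that] by simp
      then show ?thesis using assms by simp
    qed
    then show "\<exists>N. \<forall>i\<ge>N. \<forall>j\<ge>N. dist (s i) (s j) < e" by blast
  qed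
  then obtain p where p: "s \<longlonglongrightarrow> p" using Cauchy_convergent convergent_def by blast
  have "(\<lambda>n. h n - (\<i> * of_real c) *\<^sub>C s n) \<longlonglongrightarrow> g - (\<i> * of_real c) *\<^sub>C p"
    by (intro tendsto_diff h tendsto_scaleC p)
  then have "p \<in> D \<and> A p = g - (\<i> * of_real c) *\<^sub>C p"
    using s p by (intro graph_closed[of s]) auto
  then show ?thesis by (intro bexI[of _ p]) auto
qed

text \<open>
  The scaled resolvent \<open>ic (A + ic)\<^sup>-\<^sup>1\<close>, described by its graph. It is the identity in the
  limit \<open>c \<rightarrow> \<infinity>\<close>, which regularizes the evolution, and the projection to the null space
  in the limit \<open>c \<rightarrow> 0\<close>, which is the ergodic theorem behind the main result.
\<close>

definition J :: "real \<Rightarrow> 'a \<Rightarrow> 'a" where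
  "J c x = (THE z. z \<in> D \<and> A z = (\<i> * of_real c) *\<^sub>C (x - z))"

lemma J_ex1:
  assumes "0 < c"
  shows "\<exists>!z. z \<in> D \<and> A z = (\<i> * of_real c) *\<^sub>C (x - z)"
proof -
  have eq: "A z = (\<i> * of_real c) *\<^sub>C (x - z) \<longleftrightarrow>
      A z + (\<i> * of_real c) *\<^sub>C z = (\<i> * of_real c) *\<^sub>C x" for z
    by (auto simp: scaleC_diff_right algebra_simps)
  obtain z where z: "z \<in> D" "A z + (\<i> * of_real c) *\<^sub>C z = (\<i> * of_real c) *\<^sub>C x"
    using shift_surj[OF assms] by blast
  moreover have "z' = z"
    if z': "z' \<in> D" "A z' + (\<i> * of_real c) *\<^sub>C z' = (\<i> * of_real c) *\<^sub>C x" for z'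
  proof -
    have "A (z' - z) + (\<i> * of_real c) *\<^sub>C (z' - z)
        = (A z' + (\<i> * of_real c) *\<^sub>C z') - (A z + (\<i> * of_real c) *\<^sub>C z)"
      using z(1) z'(1) by (simp add: A_diff scaleC_diff_right)
    then have "A (z' - z) + (\<i> * of_real c) *\<^sub>C (z' - z) = 0"
      unfolding z(2) z'(2) by simp
    then have "c * norm (z' - z) \<le> 0"
      using shift_lower_bound[OF D_diff[OF z'(1) z(1)] assms] by simp
    then show ?thesis using assms by (simp add: mult_le_0_iff)
  qed
  ultimately show ?thesis unfolding eq by blast
qed

lemma J_in_D: "0 < c \<Longrightarrow> J c x \<in> D"
  and A_J: "0 < c \<Longrightarrow> A (J c x) = (\<i> * of_real c) *\<^sub>C (x - J c x)"
  using theI'[OF J_ex1[of c x]] by (simp_all add: J_def)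

lemma J_eqI:
  assumes "0 < c" "z \<in> D" "A z = (\<i> * of_real c) *\<^sub>C (x - z)"
  shows "J c x = z"
  using J_ex1[OF assms(1), of x] J_in_D[OF assms(1)] A_J[OF assms(1)] assms(2,3) by blast

lemma i_A_J: "0 < c \<Longrightarrow> \<i> *\<^sub>C A (J c x) = c *\<^sub>R (J c x - x)"
  using scaleC_of_real[of "- c" "x - J c x"]
  by (simp add: A_J scaleC_scaleC mult.assoc[symmetric] scaleR_diff_right)

text \<open>
  Testing \<open>iA (J c x) = c (J c x - x)\<close> with \<open>J c x\<close> and taking real parts removes the left side
  and leaves \<open>\<parallel>J c x\<parallel>\<^sup>2 = Re \<langle>x, J c x\<rangle>\<close>.
\<close>

lemma norm_J_le:
  assumes "0 < c"
  shows "norm (J c x) \<le> norm x"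
proof -
  have "Re (cinner (c *\<^sub>R (J c x - x)) (J c x)) = 0"
    using Re_i_form_eq_zero[OF J_in_D[OF assms]] unfolding i_A_J[OF assms] .
  then have "(norm (J c x))\<^sup>2 = Re (cinner x (J c x))"
    using assms by (simp add: cinner.scaleR_left cinner.diff_left cinner_self)
  then have "norm (J c x) * norm (J c x) \<le> norm x * norm (J c x)"
    using Re_cinner_le[of x "J c x"] by (simp add: power2_eq_square)
  then show ?thesis by (cases "J c x = 0") auto
qed

lemma bounded_linear_J:
  assumes "0 < c"
  shows "bounded_linear (J c)"
proof (rule bounded_linear_intro[where K = 1])
  show "J c (x + y) = J c x + J c y" for x y
    using assms by (intro J_eqI)
      (auto simp: J_in_D A_J D_add A_add algebra_simps simp flip: scaleC_add_right)
  show "J c (r *\<^sub>R x) = r *\<^sub>R J c x" for r x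
    using assms by (intro J_eqI)
      (auto simp: J_in_D A_J D_scaleR A_scaleR scaleC_scaleR simp flip: scaleR_diff_right)
  show "norm (J c x) \<le> norm x * 1" for x
    using norm_J_le[OF assms] by simp
qed

lemma J_commutes:
  assumes "0 < c" "x \<in> D"
  shows "A (J c x) = J c (A x)"
proof -
  have "A (J c x) \<in> D" unfolding A_J[OF assms(1)] using assms by (intro D_scaleC D_diff J_in_D)
  moreover have "A (A (J c x)) = (\<i> * of_real c) *\<^sub>C (A x - A (J c x))"
    by (subst (1) A_J[OF assms(1)]) (use assms in \<open>simp add: A_scaleC A_diff D_diff J_in_D\<close>)
  ultimately show ?thesis using J_eqI[OF assms(1)] by metis
qed

text \<open>
  On the domain \<open>J c z - z\<close> is \<open>1/c\<close> times the bounded vector \<open>J c (iA z)\<close>; density and the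
  uniform bound on \<open>J c\<close> extend the convergence to all vectors.
\<close>

lemma J_tendsto_id: "((\<lambda>c. J c x) \<longlongrightarrow> x) at_top"
proof (rule tendstoI)
  fix e :: real assume "0 < e"
  obtain z where z: "z \<in> D" "dist z x < e / 3"
    using D_dense \<open>0 < e\<close> closure_approachable[of x D] by (metis UNIV_I zero_less_divide_iff zero_less_numeral)
  have "eventually (\<lambda>c. norm (A z) / c < e / 3) at_top"
    using \<open>0 < e\<close> by (intro order_tendstoD(2)[OF tendsto_divide_0[OF tendsto_const]] )
      (auto simp: filterlim_ident intro: filterlim_at_top_imp_at_infinity)
  then show "eventually (\<lambda>c. dist (J c x) x < e) at_top"
    using eventually_gt_at_top[of 0]
  proof eventually_elim
    case (elim c)
    interpret J: bounded_linear "J c" by (rule bounded_linear_J) fact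
    have "c * norm (J c z - z) = norm (J c (A z))"
      using arg_cong[OF i_A_J[of c z], of norm] elim z by (simp add: norm_scaleC J_commutes)
    also have "\<dots> \<le> norm (A z)" using elim by (intro norm_J_le)
    finally have "norm (J c z - z) \<le> norm (A z) / c" using elim by (simp add: field_simps)
    moreover have "norm (J c (x - z)) \<le> norm (x - z)" using elim by (intro norm_J_le)
    moreover have "norm (J c x - x) \<le> norm (J c (x - z)) + norm (J c z - z) + norm (z - x)"
    proof -
      have split: "J c x - x = J c (x - z) + (J c z - z) + (z - x)" by (simp add: J.diff)
      show ?thesis
        unfolding split by (intro order_trans[OF norm_triangle_ineq] add_right_mono
            norm_triangle_ineq order_refl)
    qed
    ultimately show ?case
      using elim(1) z(2) norm_minus_commute[of z x] unfolding dist_norm by linarith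
  qed
qed

text \<open>
  The orthogonal complement of the null space is the closure of the range of \<open>A\<close>, and on the
  range \<open>J c (A z) = ic (z - J c z)\<close> is of order \<open>c\<close>.
\<close>

lemma J_tendsto_0_if_orthogonal_null_space:
  assumes "\<And>n. n \<in> null_space D A \<Longrightarrow> cinner y n = 0"
  shows "((\<lambda>c. J c y) \<longlongrightarrow> 0) (at_right 0)"
proof (rule tendstoI)
  fix e :: real assume "0 < e"
  have "y \<in> closure (A ` D)"
  proof (rule in_closure_if_annihilated)
    show "0 \<in> A ` D"
      using D_zero A_scaleR[OF D_zero, of 0] by (intro image_eqI[of _ _ 0]) auto
    show "u + v \<in> A ` D" if "u \<in> A ` D" "v \<in> A ` D" for u v
      using that by (auto simp: A_add[symmetric] D_add)
    show "k *\<^sub>C u \<in> A ` D" if "u \<in> A ` D" for k u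
      using that by (auto simp: A_scaleC[symmetric] D_scaleC)
    fix v assume "\<And>z. z \<in> A ` D \<Longrightarrow> cinner z v = 0"
    then have "v \<in> D \<and> A v = 0" using graph_iff[of v 0] by (auto simp: cinner.zero_right)
    then show "cinner y v = 0" using assms by (simp add: null_space_def)
  qed
  then obtain z where z: "z \<in> D" "dist (A z) y < e / 2"
    using \<open>0 < e\<close> closure_approachable[of y "A ` D"] by (metis half_gt_zero imageE)
  have "((\<lambda>c. c * (2 * norm z)) \<longlongrightarrow> 0 * (2 * norm z)) (at_right 0)"
    by (intro tendsto_intros)
  then have "eventually (\<lambda>c. c * (2 * norm z) < e / 2) (at_right 0)"
    using \<open>0 < e\<close> by (intro order_tendstoD(2)[where y = "0 * (2 * norm z)"]) auto
  then show "eventually (\<lambda>c. dist (J c y) 0 < e) (at_right 0)"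
    using eventually_at_right_less[of 0]
  proof eventually_elim
    case (elim c)
    interpret J: bounded_linear "J c" by (rule bounded_linear_J) fact
    have "norm (J c (A z)) = c * norm (z - J c z)"
      using elim z A_J[of c z] by (simp add: J_commutes[symmetric] norm_scaleC norm_mult)
    also have "\<dots> \<le> c * (2 * norm z)"
      using norm_J_le[of c z] norm_triangle_ineq4[of z "J c z"] elim by (intro mult_left_mono) auto
    finally have "norm (J c (A z)) < e / 2" using elim by simp
    moreover have "norm (J c (y - A z)) \<le> norm (y - A z)" using elim by (intro norm_J_le)
    moreover have "norm (J c y) \<le> norm (J c (y - A z)) + norm (J c (A z))"
      using norm_triangle_ineq[of "J c (y - A z)" "J c (A z)"] by (simp add: J.diff)
    ultimately show ?case using z by (simp add: dist_norm norm_minus_commute)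
  qed
qed

end

section \<open>Exponentials of linear contractions\<close>

text \<open>
  This serves twice: for the partial sums of the exponential series, and for the passage
  from the regularized flows to the evolution of \<open>iA\<close>.
\<close>

lemma has_vector_derivative_uniform_limit:
  fixes f :: "nat \<Rightarrow> real \<Rightarrow> 'a::banach"
  assumes S: "convex S" and t: "t \<in> S"
    and deriv: "\<And>n s. s \<in> S \<Longrightarrow> (f n has_vector_derivative f' n s) (at s within S)"
    and unif: "uniform_limit S f' g' sequentially"
    and lim: "\<And>s. s \<in> S \<Longrightarrow> (\<lambda>n. f n s) \<longlonglongrightarrow> g s"
  shows "(g has_vector_derivative g' t) (at t within S)"
proof -
  have "\<exists>h. \<forall>s\<in>S. (\<lambda>n. f n s) \<longlonglongrightarrow> h s \<and>
      (h has_derivative (\<lambda>k. k *\<^sub>R g' s)) (at s within S)"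
  proof (rule has_derivative_sequence[where f = f])
    show "convex S" "t \<in> S" "(\<lambda>n. f n t) \<longlonglongrightarrow> g t" by (fact S t lim[OF t])+
    show "(f n has_derivative (\<lambda>k. k *\<^sub>R f' n s)) (at s within S)" if "s \<in> S" for n s
      using deriv[OF that] by (simp add: has_vector_derivative_def)
    fix e :: real assume "0 < e"
    with unif have "\<forall>\<^sub>F n in sequentially. \<forall>s\<in>S. dist (f' n s) (g' s) < e"
      by (simp add: uniform_limit_iff)
    then show "\<forall>\<^sub>F n in sequentially. \<forall>s\<in>S. \<forall>k. norm (k *\<^sub>R f' n s - k *\<^sub>R g' s) \<le> e * norm k"
    proof eventually_elim
      case (elim n)
      show ?case
      proof (intro ballI allI)
        fix s k assume "s \<in> S"
        then have "\<bar>k\<bar> * norm (f' n s - g' s) \<le> \<bar>k\<bar> * e"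
          using elim by (intro mult_left_mono) (auto simp: dist_norm intro: less_imp_le)
        then show "norm (k *\<^sub>R f' n s - k *\<^sub>R g' s) \<le> e * norm k"
          by (simp add: scaleR_diff_right[symmetric] mult.commute)
      qed
    qed
  qed
  then obtain h where h: "\<And>s. s \<in> S \<Longrightarrow> (\<lambda>n. f n s) \<longlonglongrightarrow> h s"
      "\<And>s. s \<in> S \<Longrightarrow> (h has_vector_derivative g' s) (at s within S)"
    by (auto simp: has_vector_derivative_def)
  have "h s = g s" if "s \<in> S" for s
    using LIMSEQ_unique[OF h(1) lim] that by blast
  then show ?thesis
    using has_vector_derivative_transform[OF t _ h(2)[OF t]] by metis
qed

text \<open>
  The vector \<open>e\<^sup>s\<^sup>K x\<close>. Expanding it vector by vector takes the place of a power series in an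
  algebra of operators.
\<close>

definition exp_apply :: "('a::banach \<Rightarrow> 'a) \<Rightarrow> real \<Rightarrow> 'a \<Rightarrow> 'a" where
  "exp_apply K s x = (\<Sum>n. (s ^ n / fact n) *\<^sub>R (K ^^ n) x)"

locale linear_contraction = bounded_linear K for K :: "'a::banach \<Rightarrow> 'a" +
  assumes contraction: "norm (K x) \<le> norm x"
begin

lemma norm_funpow_le: "norm ((K ^^ n) x) \<le> norm x"
  by (induction n) (auto intro: order_trans[OF contraction])

lemma norm_exp_term_le: 
  assumes "\<bar>s\<bar> \<le> r"
  shows "norm ((s ^ n / fact n) *\<^sub>R (K ^^ n) x) \<le> (r ^ n / fact n) * norm x"
proof -
  have "\<bar>s ^ n / fact n\<bar> \<le> r ^ n / fact n"
    using assms by (auto simp: power_abs intro!: divide_right_mono power_mono)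
  then have "\<bar>s ^ n / fact n\<bar> * norm ((K ^^ n) x) \<le> (r ^ n / fact n) * norm x"
    using assms by (intro mult_mono norm_funpow_le) auto
  then show ?thesis by simp
qed

lemma summable_exp_majorant: "summable (\<lambda>n. (r ^ n / fact n) * norm (x::'a))" for r :: real
  using summable_exp[of r] by (intro summable_mult2) (simp add: divide_inverse mult.commute)

lemma summable_exp_apply: "summable (\<lambda>n. (s ^ n / fact n) *\<^sub>R (K ^^ n) x)"
  by (rule summable_comparison_test[OF _ summable_exp_majorant[of "\<bar>s\<bar>" x]])
    (use norm_exp_term_le[of s "\<bar>s\<bar>"] in blast)

lemma norm_exp_apply_le:
  assumes "0 \<le> s"
  shows "norm (exp_apply K s x) \<le> exp s * norm x"
proof -
  have "norm (exp_apply K s x) \<le> (\<Sum>n. (s ^ n / fact n) * norm x)"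
    unfolding exp_apply_def
    by (intro norm_suminf_le summable_exp_majorant norm_exp_term_le) (use assms in auto)
  also have "\<dots> = exp s * norm x"
    using summable_exp[of s]
    by (subst suminf_mult2[symmetric]) (auto simp: exp_def divide_inverse mult.commute)
  finally show ?thesis .
qed

lemma exp_apply_commute: "exp_apply K s (K x) = K (exp_apply K s x)"
  using suminf[OF summable_exp_apply, of s x] by (simp add: exp_apply_def scaleR funpow_swap1)

lemma linear_funpow: "linear (K ^^ n)"
  by (induction n) (auto simp: linear_iff add scaleR)

lemma exp_apply_add: "exp_apply K s (x + y) = exp_apply K s x + exp_apply K s y"
  unfolding exp_apply_def
  by (simp add: suminf_add[OF summable_exp_apply summable_exp_apply] linear_add[OF linear_funpow] scaleR_add_right)

lemma exp_apply_scaleR: "exp_apply K s (r *\<^sub>R x) = r *\<^sub>R exp_apply K s x"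
  unfolding exp_apply_def
  by (simp add: suminf_scaleR_right[OF summable_exp_apply] linear_scale[OF linear_funpow] mult.commute)

lemma exp_apply_zero: "exp_apply K 0 x = x"
  unfolding exp_apply_def by (subst suminf_finite[of "{0}"]) auto

lemma exp_apply_has_vector_derivative:
  "((\<lambda>s. exp_apply K s x) has_vector_derivative K (exp_apply K s x)) (at s)"
proof -
  define r where "r = \<bar>s\<bar> + 1"
  let ?S = "{- r<..<r}"
  let ?p = "\<lambda>n s y. \<Sum>k<n. (s ^ k / fact k) *\<^sub>R (K ^^ k) y"
  have lim: "(\<lambda>n. ?p n s y) \<longlonglongrightarrow> exp_apply K s y" for s y
    unfolding exp_apply_def by (rule summable_LIMSEQ[OF summable_exp_apply])
  have "((\<lambda>s. exp_apply K s x) has_vector_derivative exp_apply K s (K x)) (at s within ?S)"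
  proof (rule has_vector_derivative_uniform_limit)
    show "convex ?S" "s \<in> ?S" by (auto simp: r_def)
    show "(\<lambda>n. ?p (Suc n) s x) \<longlonglongrightarrow> exp_apply K s x" for s
      by (rule LIMSEQ_Suc[OF lim])
    \<comment> \<open>Differentiation drops the constant term, which turns a partial sum for \<open>x\<close> into the
        previous partial sum for \<open>K x\<close>.\<close>
    show "((\<lambda>s. ?p (Suc n) s x) has_vector_derivative ?p n s (K x)) (at s within ?S)" for n s
    proof -
      have power: "((\<lambda>s. s ^ Suc k / fact (Suc k)) has_real_derivative s ^ k / fact k) (at s within ?S)" for k
        by (rule derivative_eq_intros refl | simp)+
      have "((\<lambda>s. x + (\<Sum>k<n. (s ^ Suc k / fact (Suc k)) *\<^sub>R (K ^^ Suc k) x))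
          has_vector_derivative 0 + (\<Sum>k<n. (s ^ k / fact k) *\<^sub>R (K ^^ Suc k) x)) (at s within ?S)"
        by (intro has_vector_derivative_add has_vector_derivative_const has_vector_derivative_sum)
          (use has_vector_derivative_scaleR[OF power has_vector_derivative_const] in simp)
      then show ?thesis
        by (simp add: sum.lessThan_Suc_shift funpow_swap1 del: fact_Suc power_Suc sum.lessThan_Suc)
    qed
    show "uniform_limit ?S (\<lambda>n s. ?p n s (K x)) (\<lambda>s. exp_apply K s (K x)) sequentially"
      unfolding exp_apply_def
      by (rule Weierstrass_m_test[OF _ summable_exp_majorant[of r "K x"]], rule norm_exp_term_le) auto
  qed
  moreover have "at s within ?S = at s"
    by (rule at_within_open) (auto simp: r_def)
  ultimately show ?thesis by (simp add: exp_apply_commute)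
qed

end

section \<open>Energy estimates\<close>

lemma growth_bound:
  fixes g :: "real \<Rightarrow> real"
  assumes "0 \<le> t"
    and deriv: "\<And>s. 0 \<le> s \<Longrightarrow> (g has_real_derivative g' s) (at s within {0..})"
    and bound: "\<And>s. 0 \<le> s \<Longrightarrow> g' s \<le> C"
  shows "g t \<le> g 0 + C * t"
proof -
  have "(g has_derivative (*) (g' s)) (at s within {0..t})" if "0 \<le> s" "s \<le> t" for s
    using DERIV_subset[OF deriv[OF that(1)], of "{0..t}"] by (auto simp: has_field_derivative_def)
  then obtain s where "s \<in> {0..t}" "g t - g 0 = g' s * (t - 0)"
    using mvt_very_simple[OF assms(1), of g "\<lambda>s. (*) (g' s)"] by blast
  moreover have "g' s * t \<le> C * t" using calculation bound assms(1) by (intro mult_right_mono) auto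
  ultimately show ?thesis by simp
qed

lemma norm_square_has_real_derivative:
  fixes w :: "real \<Rightarrow> 'a::chilbert_space"
  assumes "(w has_vector_derivative w') (at t within S)"
  shows "((\<lambda>t. (norm (w t))\<^sup>2) has_real_derivative 2 * Re (cinner w' (w t))) (at t within S)"
proof -
  have "((\<lambda>t. Re (cinner (w t) (w t))) has_vector_derivative
      Re (cinner (w t) w' + cinner w' (w t))) (at t within S)"
    by (intro bounded_linear.has_vector_derivative[OF bounded_linear_Re]
        cinner.has_vector_derivative assms)
  moreover have "Re (cinner (w t) w') = Re (cinner w' (w t))"
    by (subst cinner_commute) simp
  ultimately show ?thesis
    by (simp add: cinner_self has_real_derivative_iff_has_vector_derivative flip: of_real_power)
qed

section \<open>The evolution generated by a selfadjoint operator\<close>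

context selfadjoint
begin

lemma linear_contraction_J: "0 < c \<Longrightarrow> linear_contraction (J c)"
  by (simp add: linear_contraction_def linear_contraction_axioms_def bounded_linear_J norm_J_le)

text \<open>
  The flow of the bounded operator \<open>iAJ\<^sub>c = c (J\<^sub>c - 1)\<close>. Splitting off the factor
  \<open>e\<^sup>-\<^sup>c\<^sup>t\<close> leaves a Poisson average of the powers of the contraction \<open>J\<^sub>c\<close>, so that the
  norm bound is visible.
\<close>

definition yosida_flow :: "real \<Rightarrow> real \<Rightarrow> 'a \<Rightarrow> 'a" where
  "yosida_flow c t x = exp (- c * t) *\<^sub>R exp_apply (J c) (c * t) x"

lemma norm_yosida_flow_le:
  assumes "0 < c" "0 \<le> t"
  shows "norm (yosida_flow c t x) \<le> norm x"
proof -
  interpret linear_contraction "J c" by (rule linear_contraction_J) fact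
  have "norm (yosida_flow c t x) \<le> exp (- c * t) * (exp (c * t) * norm x)"
    unfolding yosida_flow_def norm_scaleR
    using norm_exp_apply_le[of "c * t" x] assms by (simp add: mult_left_mono)
  also have "\<dots> = norm x"
    by (simp add: mult.assoc[symmetric] exp_add[symmetric])
  finally show ?thesis .
qed

lemma yosida_flow_diff:
  assumes "0 < c"
  shows "yosida_flow c t (x - y) = yosida_flow c t x - yosida_flow c t y"
proof -
  interpret linear_contraction "J c" by (rule linear_contraction_J) fact
  show ?thesis
    using exp_apply_add[of "c * t" "x - y" y]
    by (simp add: yosida_flow_def scaleR_diff_right[symmetric])
qed

lemma yosida_flow_zero: "0 < c \<Longrightarrow> yosida_flow c 0 x = x"
  using linear_contraction.exp_apply_zero[OF linear_contraction_J] by (simp add: yosida_flow_def)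

lemma yosida_flow_generator:
  assumes "0 < c"
  shows "yosida_flow c t (\<i> *\<^sub>C A (J c x)) = \<i> *\<^sub>C A (J c (yosida_flow c t x))"
proof -
  interpret linear_contraction "J c" by (rule linear_contraction_J) fact
  have "yosida_flow c t (c *\<^sub>R y) = c *\<^sub>R yosida_flow c t y" for y
    by (simp add: yosida_flow_def exp_apply_scaleR)
  moreover have "yosida_flow c t (J c x) = J c (yosida_flow c t x)"
    by (simp add: yosida_flow_def exp_apply_commute scaleR)
  ultimately show ?thesis by (simp add: i_A_J[OF assms] yosida_flow_diff[OF assms])
qed

lemma yosida_flow_has_vector_derivative:
  assumes "0 < c"
  shows "((\<lambda>t. yosida_flow c t x) has_vector_derivative
           \<i> *\<^sub>C A (J c (yosida_flow c t x))) (at t within S)"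
proof -
  interpret linear_contraction "J c" by (rule linear_contraction_J) fact
  have inner: "((\<lambda>t. c * t) has_vector_derivative c) (at t within S)"
    by (rule derivative_eq_intros refl | simp)+
  have E: "((\<lambda>t. exp_apply (J c) (c * t) x) has_vector_derivative
      c *\<^sub>R J c (exp_apply (J c) (c * t) x)) (at t within S)"
    using vector_diff_chain_within[OF inner
        has_vector_derivative_at_within[OF exp_apply_has_vector_derivative[of x "c * t"]]]
    by (simp add: o_def)
  have "((\<lambda>t. exp (- c * t)) has_real_derivative - c * exp (- c * t)) (at t within S)"
    by (rule derivative_eq_intros refl | simp)+
  from has_vector_derivative_scaleR[OF this E]
  have deriv: "((\<lambda>t. yosida_flow c t x) has_vector_derivative
      exp (- c * t) *\<^sub>R c *\<^sub>R J c (exp_apply (J c) (c * t) x)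
        + (- c * exp (- c * t)) *\<^sub>R exp_apply (J c) (c * t) x) (at t within S)"
    unfolding yosida_flow_def .
  have "exp (- c * t) *\<^sub>R c *\<^sub>R J c (exp_apply (J c) (c * t) x)
      + (- c * exp (- c * t)) *\<^sub>R exp_apply (J c) (c * t) x
      = \<i> *\<^sub>C A (J c (yosida_flow c t x))"
    unfolding i_A_J[OF assms] by (simp add: yosida_flow_def scaleR scaleR_diff_right mult.commute)
  with deriv show ?thesis by simp
qed

text \<open>
  The velocity is itself transported by the contractive flow, so it stays below its initial
  value \<open>\<parallel>iAJ\<^sub>c x\<parallel> = \<parallel>J\<^sub>c A x\<parallel>\<close>, uniformly in \<open>c\<close> and \<open>t\<close>.
\<close>

lemma norm_yosida_velocity_le:
  assumes "0 < c" "0 \<le> t" "x \<in> D"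
  shows "norm (\<i> *\<^sub>C A (J c (yosida_flow c t x))) \<le> norm (A x)"
proof -
  have "norm (\<i> *\<^sub>C A (J c (yosida_flow c t x))) \<le> norm (\<i> *\<^sub>C A (J c x))"
    unfolding yosida_flow_generator[OF assms(1), symmetric]
    by (rule norm_yosida_flow_le) fact+
  also have "\<dots> \<le> norm (A x)"
    using norm_J_le[OF assms(1)] by (simp add: norm_scaleC J_commutes[OF assms(1,3)])
  finally show ?thesis .
qed

text \<open>
  The energy estimate of Kato and Komura for two regularized flows \<open>u\<close> and \<open>v\<close>, with
  \<open>p = J\<^sub>c u\<close> and \<open>q = J\<^sub>d v\<close>. The velocities differ by \<open>iA(p - q)\<close>, and the real part of its
  inner product with \<open>p - q\<close> vanishes; \<open>u - v\<close> deviates from \<open>p - q\<close> only by the velocities,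
  which are bounded, divided by \<open>c\<close> and \<open>d\<close>.
\<close>

lemma yosida_flow_dist_le:
  assumes c: "0 < c" and d: "0 < d" and t: "0 \<le> t" and x: "x \<in> D"
  shows "(norm (yosida_flow c t x - yosida_flow d t x))\<^sup>2 \<le> 4 * (norm (A x))\<^sup>2 * (1 / c + 1 / d) * t"
proof -
  define M where "M = norm (A x)"
  let ?u = "\<lambda>s. yosida_flow c s x" and ?v = "\<lambda>s. yosida_flow d s x"
  let ?u' = "\<lambda>s. \<i> *\<^sub>C A (J c (?u s))" and ?v' = "\<lambda>s. \<i> *\<^sub>C A (J d (?v s))"
  have "(norm (?u t - ?v t))\<^sup>2 \<le> (norm (?u 0 - ?v 0))\<^sup>2 + (4 * M\<^sup>2 * (1 / c + 1 / d)) * t"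
  proof (rule growth_bound[OF t])
    show "((\<lambda>s. (norm (?u s - ?v s))\<^sup>2) has_real_derivative
        2 * Re (cinner (?u' s - ?v' s) (?u s - ?v s))) (at s within {0..})" for s
      by (intro norm_square_has_real_derivative has_vector_derivative_diff
          yosida_flow_has_vector_derivative c d)
    fix s :: real assume s: "0 \<le> s"
    define p q where "p = J c (?u s)" and "q = J d (?v s)"
    have pq: "p \<in> D" "q \<in> D" using c d by (simp_all add: p_def q_def J_in_D)
    have u: "?u s = p - (1 / c) *\<^sub>R ?u' s" and v: "?v s = q - (1 / d) *\<^sub>R ?v' s"
      using c d by (simp_all add: p_def q_def i_A_J)
    have M: "norm (?u' s) \<le> M" "norm (?v' s) \<le> M"
      using s x c d by (auto simp: M_def norm_yosida_velocity_le)
    define e where "e = (1 / c) *\<^sub>R ?u' s - (1 / d) *\<^sub>R ?v' s"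
    have diff: "?u s - ?v s = (p - q) - e" by (subst u, subst v) (simp add: e_def)
    have "?u' s - ?v' s = \<i> *\<^sub>C A (p - q)"
      using pq by (simp add: A_diff scaleC_diff_right p_def q_def)
    then have "Re (cinner (?u' s - ?v' s) (p - q)) = 0"
      using Re_i_form_eq_zero[OF D_diff[OF pq]] by simp
    then have "Re (cinner (?u' s - ?v' s) (?u s - ?v s)) = - Re (cinner (?u' s - ?v' s) e)"
      unfolding diff by (simp add: cinner.diff_right)
    also have "\<dots> \<le> norm (?u' s - ?v' s) * norm e"
      using abs_Re_cinner_le[of "?u' s - ?v' s" e] by linarith
    also have "\<dots> \<le> (2 * M) * (M * (1 / c + 1 / d))"
    proof (rule mult_mono)
      show "norm (?u' s - ?v' s) \<le> 2 * M"
        using norm_triangle_ineq4[of "?u' s" "?v' s"] M by linarith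
      have "norm e \<le> (1 / c) * norm (?u' s) + (1 / d) * norm (?v' s)"
        using norm_triangle_ineq4[of "(1 / c) *\<^sub>R ?u' s" "(1 / d) *\<^sub>R ?v' s"] c d
        by (simp add: e_def)
      also have "\<dots> \<le> (1 / c) * M + (1 / d) * M"
        using M c d by (intro add_mono mult_left_mono) auto
      finally show "norm e \<le> M * (1 / c + 1 / d)" by (simp add: distrib_left mult.commute)
    qed (auto simp: M_def)
    finally show "2 * Re (cinner (?u' s - ?v' s) (?u s - ?v s)) \<le> 4 * M\<^sup>2 * (1 / c + 1 / d)"
      by (simp add: power2_eq_square)
  qed
  then show ?thesis using c d by (simp add: yosida_flow_zero M_def)
qed

definition evolution :: "real \<Rightarrow> 'a \<Rightarrow> 'a" where
  "evolution t x = lim (\<lambda>n. yosida_flow (real (Suc n)) t x)"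

text \<open>
  The energy estimate gives convergence for initial values in the domain only; contractivity
  and density give it for all, which is needed because the velocity \<open>iAx\<close> may lie outside
  the domain.
\<close>

lemma uniform_limit_yosida_flow:
  "uniform_limit {0..r} (\<lambda>n t. yosida_flow (real (Suc n)) t x) (\<lambda>t. evolution t x) sequentially"
proof -
  let ?T = "\<lambda>n. yosida_flow (real (Suc n))"
  have "uniformly_Cauchy_on {0..r} (\<lambda>n t. ?T n t x)"
  proof (rule uniformly_Cauchy_onI)
    fix e :: real assume "0 < e"
    obtain z where z: "z \<in> D" "dist z x < e / 4"
      using D_dense \<open>0 < e\<close> closure_approachable[of x D] by (metis UNIV_I zero_less_divide_iff zero_less_numeral)
    define C where "C = 4 * (norm (A z))\<^sup>2 * \<bar>r\<bar>"
    have C: "0 \<le> C" by (simp add: C_def)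
    have "(\<lambda>n. C * (2 / real (Suc n))) \<longlonglongrightarrow> C * 0"
      by (intro tendsto_mult tendsto_const LIMSEQ_Suc[OF lim_const_over_n])
    then have "\<forall>\<^sub>F n in sequentially. C * (2 / real (Suc n)) < (e / 2)\<^sup>2"
      using \<open>0 < e\<close> by (intro order_tendstoD(2)[where y = "C * 0"]) auto
    then obtain N where N: "C * (2 / real (Suc N)) < (e / 2)\<^sup>2"
      by (auto simp: eventually_sequentially)
    have "dist (?T m t x) (?T n t x) < e" if t: "t \<in> {0..r}" and mn: "N \<le> m" "N \<le> n" for t m n
    proof -
      have "(norm (?T m t z - ?T n t z))\<^sup>2
          \<le> 4 * (norm (A z))\<^sup>2 * (1 / real (Suc m) + 1 / real (Suc n)) * t"
        using t z by (intro yosida_flow_dist_le) auto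
      also have "\<dots> \<le> 4 * (norm (A z))\<^sup>2 * (1 / real (Suc N) + 1 / real (Suc N)) * \<bar>r\<bar>"
        using t mn by (intro mult_mono add_mono frac_le) auto
      also have "\<dots> = C * (2 / real (Suc N))" by (simp add: C_def)
      finally have "(norm (?T m t z - ?T n t z))\<^sup>2 < (e / 2)\<^sup>2" using N by linarith
      then have 1: "norm (?T m t z - ?T n t z) < e / 2"
        by (rule power_less_imp_less_base) (use \<open>0 < e\<close> in simp)
      have 2: "norm (?T k t z - ?T k t x) < e / 4" for k
        using norm_yosida_flow_le[of "real (Suc k)" t "z - x"] t z
        by (simp add: yosida_flow_diff dist_norm)
      have "dist (?T m t x) (?T n t x)
          \<le> dist (?T m t z) (?T m t x) + dist (?T m t z) (?T n t z) + dist (?T n t z) (?T n t x)"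
        by metric
      then show ?thesis using 1 2[of m] 2[of n] by (simp add: dist_norm)
    qed
    then show "\<exists>M. \<forall>t\<in>{0..r}. \<forall>m\<ge>M. \<forall>n\<ge>M. dist (?T m t x) (?T n t x) < e" by blast
  qed
  then show ?thesis
    unfolding evolution_def
    by (simp add: Cauchy_uniformly_convergent flip: uniformly_convergent_uniform_limit_iff)
qed

lemma uniform_limit_yosida_flow_seq:
  assumes "z \<longlonglongrightarrow> x"
  shows "uniform_limit {0..r} (\<lambda>n t. yosida_flow (real (Suc n)) t (z n)) (\<lambda>t. evolution t x) sequentially"
proof (rule uniform_limitI)
  fix e :: real assume "0 < e"
  then have "0 < e / 2" by simp
  have "\<forall>\<^sub>F n in sequentially. dist (z n) x < e / 2"
    using tendstoD[OF assms \<open>0 < e / 2\<close>] .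
  moreover have "\<forall>\<^sub>F n in sequentially. \<forall>t\<in>{0..r}.
      dist (yosida_flow (real (Suc n)) t x) (evolution t x) < e / 2"
    using uniform_limitD[OF uniform_limit_yosida_flow \<open>0 < e / 2\<close>] .
  ultimately show "\<forall>\<^sub>F n in sequentially. \<forall>t\<in>{0..r}.
      dist (yosida_flow (real (Suc n)) t (z n)) (evolution t x) < e"
  proof eventually_elim
    case (elim n)
    show ?case
    proof
      fix t assume t: "t \<in> {0..r}"
      have "dist (yosida_flow (real (Suc n)) t (z n)) (yosida_flow (real (Suc n)) t x) \<le> dist (z n) x"
        using norm_yosida_flow_le[of "real (Suc n)" t "z n - x"] t
        by (simp add: dist_norm yosida_flow_diff)
      then show "dist (yosida_flow (real (Suc n)) t (z n)) (evolution t x) < e"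
        using elim t dist_triangle_half_r
        by (meson dist_triangle_half_l dist_commute_lessI order_le_less_trans)
    qed
  qed
qed

lemma yosida_flow_tendsto:
  assumes "z \<longlonglongrightarrow> x" "0 \<le> t"
  shows "(\<lambda>n. yosida_flow (real (Suc n)) t (z n)) \<longlonglongrightarrow> evolution t x"
  using tendsto_uniform_limitI[OF uniform_limit_yosida_flow_seq[OF assms(1), of t], of t] assms(2) by simp

lemma evolution_zero: "evolution 0 x = x"
  by (simp add: evolution_def yosida_flow_zero)

lemma norm_evolution_le:
  assumes "0 \<le> t"
  shows "norm (evolution t x) \<le> norm x"
proof (rule LIMSEQ_le_const2)
  show "(\<lambda>n. norm (yosida_flow (real (Suc n)) t x)) \<longlonglongrightarrow> norm (evolution t x)"
    by (intro tendsto_norm yosida_flow_tendsto tendsto_const assms)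
  show "\<exists>N. \<forall>n\<ge>N. norm (yosida_flow (real (Suc n)) t x) \<le> norm x"
    using assms by (auto intro!: norm_yosida_flow_le)
qed

lemma yosida_generator_tendsto:
  assumes "x \<in> D"
  shows "(\<lambda>n. \<i> *\<^sub>C A (J (real (Suc n)) x)) \<longlonglongrightarrow> \<i> *\<^sub>C A x"
proof -
  have "filterlim (\<lambda>n. real (Suc n)) at_top sequentially"
    using filterlim_compose[OF filterlim_real_sequentially filterlim_Suc] .
  then have "(\<lambda>n. J (real (Suc n)) (A x)) \<longlonglongrightarrow> A x"
    by (rule filterlim_compose[OF J_tendsto_id])
  then show ?thesis
    using tendsto_scaleC[of "\<lambda>n. J (real (Suc n)) (A x)" "A x" sequentially "\<i>"] assms
    by (simp add: J_commutes)
qed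

text \<open>
  The regularized velocities converge because they are the flows of \<open>iAJ\<^sub>c x \<rightarrow> iAx\<close>. They
  are values of \<open>iA\<close> at the points \<open>J\<^sub>c w\<^sub>c\<close>, which approach \<open>S(t) x\<close>, and \<open>A\<close> is closed.
\<close>

lemma evolution_in_domain:
  assumes x: "x \<in> D" and t: "0 \<le> t"
  shows "evolution t x \<in> D \<and> \<i> *\<^sub>C A (evolution t x) = evolution t (\<i> *\<^sub>C A x)"
proof -
  let ?c = "\<lambda>n. real (Suc n)"
  let ?w = "\<lambda>n. yosida_flow (?c n) t x"
  have gen: "(\<lambda>n. \<i> *\<^sub>C A (J (?c n) (?w n))) \<longlonglongrightarrow> evolution t (\<i> *\<^sub>C A x)"
    using yosida_flow_tendsto[OF yosida_generator_tendsto[OF x] t] by (simp add: yosida_flow_generator)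
  have "J (?c n) (?w n) = ?w n + (1 / ?c n) *\<^sub>R (\<i> *\<^sub>C A (J (?c n) (?w n)))" for n
    using i_A_J[of "?c n" "?w n"] by simp
  moreover have "(\<lambda>n. ?w n + (1 / ?c n) *\<^sub>R (\<i> *\<^sub>C A (J (?c n) (?w n))))
      \<longlonglongrightarrow> evolution t x + 0 *\<^sub>R evolution t (\<i> *\<^sub>C A x)"
    by (intro tendsto_add tendsto_scaleR gen yosida_flow_tendsto tendsto_const t
        LIMSEQ_Suc[OF lim_1_over_n])
  ultimately have 1: "(\<lambda>n. J (?c n) (?w n)) \<longlonglongrightarrow> evolution t x" by simp
  have 2: "(\<lambda>n. A (J (?c n) (?w n))) \<longlonglongrightarrow> (- \<i>) *\<^sub>C evolution t (\<i> *\<^sub>C A x)"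
    using tendsto_scaleC[OF gen, of "- \<i>"] by (simp add: scaleC_scaleC)
  have "evolution t x \<in> D \<and> A (evolution t x) = (- \<i>) *\<^sub>C evolution t (\<i> *\<^sub>C A x)"
    by (rule graph_closed[OF _ 1 2]) (simp add: J_in_D)
  then show ?thesis by (simp add: scaleC_scaleC)
qed

lemma evolution_has_vector_derivative:
  assumes x: "x \<in> D" and t: "0 \<le> t"
  shows "((\<lambda>t. evolution t x) has_vector_derivative \<i> *\<^sub>C A (evolution t x)) (at t within {0..})"
proof -
  have "((\<lambda>t. evolution t x) has_vector_derivative evolution t (\<i> *\<^sub>C A x)) (at t within {0..t + 1})"
  proof (rule has_vector_derivative_uniform_limit)
    show "((\<lambda>t. yosida_flow (real (Suc n)) t x) has_vector_derivative
        yosida_flow (real (Suc n)) s (\<i> *\<^sub>C A (J (real (Suc n)) x))) (at s within {0..t + 1})" for n s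
      using yosida_flow_has_vector_derivative[of "real (Suc n)" x s] by (simp add: yosida_flow_generator)
    show "uniform_limit {0..t + 1} (\<lambda>n s. yosida_flow (real (Suc n)) s (\<i> *\<^sub>C A (J (real (Suc n)) x)))
        (\<lambda>s. evolution s (\<i> *\<^sub>C A x)) sequentially"
      by (rule uniform_limit_yosida_flow_seq[OF yosida_generator_tendsto[OF x]])
    show "(\<lambda>n. yosida_flow (real (Suc n)) s x) \<longlonglongrightarrow> evolution s x" if "s \<in> {0..t + 1}" for s
      using that by (intro yosida_flow_tendsto tendsto_const) auto
  qed (use t in auto)
  moreover have "at t within {0..t + 1} = at t within {0..}"
    by (rule at_within_nhd[of t "{..<t + 1}"]) auto
  ultimately show ?thesis using evolution_in_domain[OF x t] by simp
qed

end

section \<open>The Cauchy problem\<close>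

context selfadjoint
begin

text \<open>
  The difference \<open>d\<close> of two solutions satisfies \<open>d' = iAd - ad\<close>, so \<open>\<parallel>d\<parallel>\<^sup>2\<close> has the derivative
  \<open>- 2a \<parallel>d\<parallel>\<^sup>2 \<le> 0\<close>.
\<close>

lemma solves_cauchy_unique:
  assumes a: "0 < a" and u: "solves_cauchy D A f a u" and v: "solves_cauchy D A f a v" and t: "0 \<le> t"
  shows "u t = v t"
proof -
  let ?d = "\<lambda>s. u s - v s"
  have "(norm (?d t))\<^sup>2 \<le> (norm (?d 0))\<^sup>2 + 0 * t"
  proof (rule growth_bound[OF t])
    fix s :: real assume s: "0 \<le> s"
    have D: "u s \<in> D" "v s \<in> D" using u v s by (auto simp: solves_cauchy_def)
    have "(?d has_vector_derivative \<i> *\<^sub>C (A (u s) + (\<i> * complex_of_real a) *\<^sub>C u s) - \<i> *\<^sub>C f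
        - (\<i> *\<^sub>C (A (v s) + (\<i> * complex_of_real a) *\<^sub>C v s) - \<i> *\<^sub>C f)) (at s within {0..})"
      using u v s by (intro has_vector_derivative_diff) (auto simp: solves_cauchy_def)
    also have "\<i> *\<^sub>C (A (u s) + (\<i> * complex_of_real a) *\<^sub>C u s) - \<i> *\<^sub>C f
        - (\<i> *\<^sub>C (A (v s) + (\<i> * complex_of_real a) *\<^sub>C v s) - \<i> *\<^sub>C f)
        = \<i> *\<^sub>C A (?d s) - a *\<^sub>R ?d s"
      using scaleC_of_real[of a "u s"] scaleC_of_real[of a "v s"] D
      by (simp add: A_diff scaleC_add_right scaleC_diff_right scaleC_scaleC scaleC_minus_left
          mult.assoc[symmetric] algebra_simps)
    finally show "((\<lambda>s. (norm (?d s))\<^sup>2) has_real_derivative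
        2 * Re (cinner (\<i> *\<^sub>C A (?d s) - a *\<^sub>R ?d s) (?d s))) (at s within {0..})"
      by (rule norm_square_has_real_derivative)
    show "2 * Re (cinner (\<i> *\<^sub>C A (?d s) - a *\<^sub>R ?d s) (?d s)) \<le> 0"
      using Re_i_form_eq_zero[OF D_diff[OF D]] a
      by (simp add: cinner.diff_left[of _ _ "?d s"] cinner.scaleR_left cinner_self)
  qed
  then show ?thesis using u v by (simp add: solves_cauchy_def)
qed

text \<open>
  The vector \<open>v = y - J a y\<close> solves \<open>(A + ia) v = f\<close> and is thus a stationary solution; the
  second term is the damped evolution that corrects the initial value to \<open>0\<close>.
\<close>

lemma solves_cauchy_explicit:
  assumes a: "0 < a" and y: "y \<in> D" "A y = f"
  shows "solves_cauchy D A f a (\<lambda>t. (y - J a y) - exp (- a * t) *\<^sub>R evolution t (y - J a y))"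
proof -
  define v where "v = y - J a y"
  define w where "w = (\<lambda>t. evolution t v)"
  let ?u = "\<lambda>t. v - exp (- a * t) *\<^sub>R w t"
  have v: "v \<in> D" using a y by (simp add: v_def D_diff J_in_D)
  have Av: "A v = f - (\<i> * of_real a) *\<^sub>C v" using a y by (simp add: v_def A_diff J_in_D A_J)
  have w: "w t \<in> D" if "0 \<le> t" for t
    using evolution_in_domain[OF v that] by (simp add: w_def)
  have "(?u has_vector_derivative \<i> *\<^sub>C (A (?u t) + (\<i> * complex_of_real a) *\<^sub>C ?u t) - \<i> *\<^sub>C f) (at t within {0..})"
    if t: "0 \<le> t" for t
  proof -
    have "((\<lambda>t. exp (- a * t)) has_real_derivative - a * exp (- a * t)) (at t within {0..})"
      by (rule derivative_eq_intros refl | simp)+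
    from has_vector_derivative_diff[OF has_vector_derivative_const has_vector_derivative_scaleR[OF this
          evolution_has_vector_derivative[OF v t]], of v]
    have "(?u has_vector_derivative
        - (exp (- a * t) *\<^sub>R \<i> *\<^sub>C A (w t) - (a * exp (- a * t)) *\<^sub>R w t)) (at t within {0..})"
      by (simp add: w_def)
    also have "- (exp (- a * t) *\<^sub>R \<i> *\<^sub>C A (w t) - (a * exp (- a * t)) *\<^sub>R w t)
        = \<i> *\<^sub>C (A (?u t) + (\<i> * complex_of_real a) *\<^sub>C ?u t) - \<i> *\<^sub>C f"
      using v w[OF t] scaleC_of_real[of a "w t"]
      by (simp add: A_diff D_scaleR A_scaleR Av scaleC_add_right scaleC_diff_right scaleC_scaleR
          scaleC_scaleC scaleC_minus_left mult.assoc[symmetric] algebra_simps)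
    finally show ?thesis .
  qed
  moreover have "?u t \<in> D" if "0 \<le> t" for t
    using v w[OF that] by (intro D_diff D_scaleR)
  moreover have "?u 0 = 0" by (simp add: w_def evolution_zero)
  ultimately show ?thesis by (simp add: solves_cauchy_def v_def w_def)
qed

lemma cauchy_solution_eq:
  assumes a: "0 < a" and y: "y \<in> D" "A y = f" and t: "0 \<le> t"
  shows "cauchy_solution D A f a t = (y - J a y) - exp (- a * t) *\<^sub>R evolution t (y - J a y)"
proof -
  let ?u = "\<lambda>t. (y - J a y) - exp (- a * t) *\<^sub>R evolution t (y - J a y)"
  \<comment> \<open>The definite description is restricted to functions that vanish at negative times.\<close>
  let ?z = "\<lambda>t. if t < 0 then 0 else ?u t"
  have u: "solves_cauchy D A f a ?u" using a y by (rule solves_cauchy_explicit)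
  have u0: "solves_cauchy D A f a ?z"
    unfolding solves_cauchy_def
  proof (intro conjI allI impI)
    show "?z 0 = 0" using u by (simp add: solves_cauchy_def)
    fix t :: real assume t: "0 \<le> t"
    then show "?z t \<in> D" using u by (simp add: solves_cauchy_def)
    have "(?u has_vector_derivative \<i> *\<^sub>C (A (?u t) + (\<i> * complex_of_real a) *\<^sub>C ?u t) - \<i> *\<^sub>C f) (at t within {0..})"
      using u t by (simp add: solves_cauchy_def)
    then have "(?z has_vector_derivative \<i> *\<^sub>C (A (?u t) + (\<i> * complex_of_real a) *\<^sub>C ?u t) - \<i> *\<^sub>C f) (at t within {0..})"
      by (rule has_vector_derivative_transform[rotated 2]) (use t in auto)
    then show "(?z has_vector_derivative \<i> *\<^sub>C (A (?z t) + (\<i> * complex_of_real a) *\<^sub>C ?z t) - \<i> *\<^sub>C f) (at t within {0..})"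
      using t by simp
  qed
  have "cauchy_solution D A f a = ?z"
    unfolding cauchy_solution_def
  proof (rule the_equality)
    show "solves_cauchy D A f a ?z \<and> (\<forall>t<0. ?z t = 0)" using u0 by simp
    fix v assume v: "solves_cauchy D A f a v \<and> (\<forall>t<0. v t = 0)"
    show "v = ?z"
    proof
      show "v t = ?z t" for t
        using v solves_cauchy_unique[OF a _ u0, of v t] by (cases "t < 0") auto
    qed
  qed
  then show ?thesis using t by simp
qed

end

theorem theorem1:
  fixes D :: "'a::chilbert_space set" and A :: "'a \<Rightarrow> 'a" and f y :: 'a
  assumes "selfadjoint_operator D A"
    and "y \<in> D" and "A y = f"
    and "\<And>n. n \<in> null_space D A \<Longrightarrow> cinner y n = 0"
  shows "\<exists>v :: real \<Rightarrow> 'a.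
           (\<forall>a>0. ((\<lambda>t. cauchy_solution D A f a t) \<longlongrightarrow> v a) at_top) \<and>
           (v \<longlongrightarrow> y) (at_right 0)"
proof -
  interpret selfadjoint D A by (rule selfadjoint.intro) fact
  have inner: "((\<lambda>t. cauchy_solution D A f a t) \<longlongrightarrow> y - J a y) at_top" if a: "0 < a" for a
  proof -
    let ?v = "y - J a y"
    have "filterlim (\<lambda>t. - a * t) at_bot at_top"
      by (rule filterlim_tendsto_neg_mult_at_bot[OF tendsto_const _ filterlim_ident]) (use a in simp)
    then have "((\<lambda>t. exp (- a * t)) \<longlongrightarrow> 0) at_top"
      by (rule filterlim_compose[OF exp_at_bot])
    from tendsto_mult[OF this tendsto_const, of "norm ?v"]
    have decay: "((\<lambda>t. exp (- a * t) * norm ?v) \<longlongrightarrow> 0) at_top" by simp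
    have "((\<lambda>t. exp (- a * t) *\<^sub>R evolution t ?v) \<longlongrightarrow> 0) at_top"
    proof (rule Lim_null_comparison[OF _ decay])
      show "\<forall>\<^sub>F t in at_top. norm (exp (- a * t) *\<^sub>R evolution t ?v) \<le> exp (- a * t) * norm ?v"
        using eventually_ge_at_top[of 0] by eventually_elim (simp add: norm_evolution_le)
    qed
    from tendsto_diff[OF tendsto_const this, of ?v]
    have "((\<lambda>t. ?v - exp (- a * t) *\<^sub>R evolution t ?v) \<longlongrightarrow> ?v) at_top" by simp
    moreover have "\<forall>\<^sub>F t in at_top. ?v - exp (- a * t) *\<^sub>R evolution t ?v = cauchy_solution D A f a t"
      using eventually_ge_at_top[of 0] by eventually_elim (rule cauchy_solution_eq[OF a assms(2,3), symmetric])
    ultimately show ?thesis by (rule Lim_transform_eventually)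
  qed
  have "((\<lambda>a. y - J a y) \<longlongrightarrow> y - 0) (at_right 0)"
    by (intro tendsto_diff tendsto_const J_tendsto_0_if_orthogonal_null_space) (fact assms(4))
  then have "((\<lambda>a. y - J a y) \<longlongrightarrow> y) (at_right 0)" by simp
  with inner show ?thesis by (intro exI[of _ "\<lambda>a. y - J a y"] conjI allI impI)
qed

end
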